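(* Let $0<\eta<1$ and let $f$ be a probability density on the non-negative integers with finite $(1+\eta)$-moment, i.e. $\mathbb{E}(\mathscr{D}^{1+\eta})<\infty$ for a random variable $\mathscr{D}$ with density $f$; let $f^*$ be the size-biased version of $f$. Let $\{G_n\}_{n\ge1}$ be any sequence of random undirected (multi)graphs, $G_n$ having $n$ nodes, satisfying the following two assumptions. (1) There exist some $\alpha,\varepsilon>0$ such that, with $\Omega_n=\{\max\{d_1(f_n,f),d_{tv}(f_n^*,f^* )\}\le n^{-\varepsilon}\}$, we have $\mathbb{P}(\Omega_n^c)=O(n^{-\alpha})$ as $n\to\infty$. (2) There exist a joint probability density function $h(k,\ell)$ on the positive integers and some $\kappa>0$ such that, with $$\Gamma_n=\left\{\sum_{k,\ell=1}^\infty|h_n(k,\ell)-h(k,\ell)|\,\mathbf{1}\{f_n(k)>0\}\le n^{-\kappa}\right\},$$ we have $\lim_{n\to\infty}\mathbb{P}(\Gamma_n)=1$. Then, for each fixed $k$ such that $f(k)>0$ and each $0<\delta<\min\left\{\frac{\eta}{8+4\eta},\kappa\right\}$, $$\lim_{n\to\infty}\mathbb{P}\left(|\Theta_n(k)-\Theta(k)|>n^{-\delta}\right)=0,$$ where $\Theta_n(k)$ is the average nearest neighbor rank in $G_n$ and $$\Theta(k)=\mathbf{1}\{f(k)>0\}\,\frac{\sum_{\ell>0}h(k,\ell)F^*(\ell)}{f^*(k)},$$ with $F^*$ the cumulative distribution function of $f^*$.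
   Context: Let $G_n$ be an undirected (multi)graph with nodes $1,\dots,n$. Each undirected edge between $i$ and $j$ is replaced by two directed edges $i\to j$ and $j\to i$; $G_{ij}$ denotes the number of edges $i\to j$ (so $G_{ij}=G_{ji}$, and $G_{ii}$ is twice the number of self-loops at $i$). The degree of node $i$ is $D_i=\sum_{j=1}^nG_{ij}$, and $L_n=\sum_{i=1}^nD_i$. Empirical densities: $f_n(k)=\frac1n\sum_{i=1}^n\mathbf{1}\{D_i=k\}$, $f_n^*(k)=\frac1{L_n}\sum_{i=1}^nk\,\mathbf{1}\{D_i=k\}$, with $F_n^*(\ell)=\sum_{m\le\ell}f_n^*(m)=\frac1{L_n}\sum_{i=1}^nD_i\mathbf{1}\{D_i\le\ell\}$, and the joint degree distribution $h_n(k,\ell)=\frac1{L_n}\sum_{i,j=1}^nG_{ij}\mathbf{1}\{D_i=k,D_j=\ell\}$. The average nearest neighbor rank (ANNR) is $\Theta_n(k)=\mathbf{1}\{f_n(k)>0\}\,\frac{\sum_{\ell>0}h_n(k,\ell)F_n^*(\ell)}{f_n^*(k)}$ (set to $0$ if $f_n(k)=0$). The size-biased version of $f$ is $f^*(k)=kf(k)/\sum_jjf(j)$. For densities $p,q$ on the non-negative integers with distribution functions $P,Q$, $d_1(p,q)=\sum_{k\ge0}|P(k)-Q(k)|$ and $d_{tv}(p,q)=\frac12\sum_{k\ge0}|p(k)-q(k)|$. *)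

theory Defs
  imports "HOL-Probability.Probability" "HOL-Library.Uprod" "HOL-Library.Landau_Symbols"
begin

text \<open>
  An undirected multigraph on the nodes \<open>1, \<dots>, n\<close>, given by the multiset of its undirected edges.
  An edge is an unordered pair of nodes; \<open>Upair i i\<close> is a self-loop at \<open>i\<close>.
\<close>

type_synonym multigraph = "nat uprod multiset"

definition multigraphs :: "nat \<Rightarrow> multigraph set" where
  "multigraphs n = {E. \<forall>e. e \<in># E \<longrightarrow> set_uprod e \<subseteq> {1..n}}"

text \<open>
  The number \<open>G\<^sub>i\<^sub>j\<close> of directed edges from \<open>i\<close> to \<open>j\<close> once every undirected edge \<open>{i, j}\<close> has been
  replaced by \<open>i \<rightarrow> j\<close> and \<open>j \<rightarrow> i\<close>; a self-loop at \<open>i\<close> thus yields two edges \<open>i \<rightarrow> i\<close>.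
\<close>

definition num_edges :: "multigraph \<Rightarrow> nat \<Rightarrow> nat \<Rightarrow> nat" where
  "num_edges E i j = (if i = j then 2 * count E (Upair i i) else count E (Upair i j))"

definition node_degree :: "nat \<Rightarrow> multigraph \<Rightarrow> nat \<Rightarrow> nat" where
  "node_degree n E i = (\<Sum>j=1..n. num_edges E i j)"

definition total_degree :: "nat \<Rightarrow> multigraph \<Rightarrow> nat" where
  "total_degree n E = (\<Sum>i=1..n. node_degree n E i)"

definition emp_density :: "nat \<Rightarrow> multigraph \<Rightarrow> nat \<Rightarrow> real" where
  "emp_density n E k = (1 / real n) * (\<Sum>i=1..n. of_bool (node_degree n E i = k))"

definition emp_biased_density :: "nat \<Rightarrow> multigraph \<Rightarrow> nat \<Rightarrow> real" where
  "emp_biased_density n E k =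
     (1 / real (total_degree n E)) * (\<Sum>i=1..n. real k * of_bool (node_degree n E i = k))"

definition emp_joint :: "nat \<Rightarrow> multigraph \<Rightarrow> nat \<Rightarrow> nat \<Rightarrow> real" where
  "emp_joint n E k l =
     (1 / real (total_degree n E)) *
     (\<Sum>i=1..n. \<Sum>j=1..n.
        real (num_edges E i j) * of_bool (node_degree n E i = k \<and> node_degree n E j = l))"

definition dist_fun :: "(nat \<Rightarrow> real) \<Rightarrow> nat \<Rightarrow> real" where
  "dist_fun p l = (\<Sum>m\<le>l. p m)"

definition size_biased :: "nat pmf \<Rightarrow> nat \<Rightarrow> real" where
  "size_biased f k = real k * pmf f k / (\<Sum>j. real j * pmf f j)"

text \<open>
  The distances take values in the extended non-negative reals because \<open>d1 p q\<close> is infinite for some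
  pairs of densities.
\<close>

definition d1 :: "(nat \<Rightarrow> real) \<Rightarrow> (nat \<Rightarrow> real) \<Rightarrow> ennreal" where
  "d1 p q = (\<Sum>k. ennreal \<bar>dist_fun p k - dist_fun q k\<bar>)"

definition dtv :: "(nat \<Rightarrow> real) \<Rightarrow> (nat \<Rightarrow> real) \<Rightarrow> ennreal" where
  "dtv p q = ennreal (1 / 2) * (\<Sum>k. ennreal \<bar>p k - q k\<bar>)"

text \<open>
  The average nearest neighbor rank and its limit. At \<open>k = 0\<close> the quotients have the form \<open>0 / 0\<close>
  and are \<open>0\<close> by the convention \<open>x / 0 = 0\<close>.
\<close>

definition annr :: "nat \<Rightarrow> multigraph \<Rightarrow> nat \<Rightarrow> real" where
  "annr n E k =
     of_bool (emp_density n E k > 0) *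
     ((\<Sum>\<^sub>\<infinity>l\<in>{0<..}. emp_joint n E k l * dist_fun (emp_biased_density n E) l)
        / emp_biased_density n E k)"

definition annr_limit :: "nat pmf \<Rightarrow> (nat \<times> nat) pmf \<Rightarrow> nat \<Rightarrow> real" where
  "annr_limit f h k =
     of_bool (pmf f k > 0) *
     ((\<Sum>\<^sub>\<infinity>l\<in>{0<..}. pmf h (k, l) * dist_fun (size_biased f) l) / size_biased f k)"

end

theory Submission
  imports Defs
begin

text \<open>
  The empirical size-biased density is the first marginal of the empirical joint density. Hence the
  second assumption alone bounds its distance from the marginal of \<open>h\<close> by \<open>n\<^sup>-\<^sup>\<kappa>\<close>, and the first
  assumption serves only to identify this marginal with the size-biased density of \<open>f\<close> (and to
  exclude edgeless graphs). This is why the rate does not involve \<open>\<epsilon>\<close>. Numerator and denominator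
  of the ANNR are then both within a multiple of \<open>n\<^sup>-\<^sup>\<kappa>\<close> of their limits.
\<close>

section \<open>Degrees and empirical densities of a fixed multigraph\<close>

lemma num_edges_commute: "num_edges E i j = num_edges E j i"
proof -
  have "Upair i j = Upair j i" by simp
  then show ?thesis unfolding num_edges_def by metis
qed

lemma num_edges_le_node_degree:
  assumes "j \<in> {1..n}"
  shows "num_edges E i j \<le> node_degree n E i"
  unfolding node_degree_def using assms by (intro member_le_sum) auto

lemma node_degree_le_total_degree:
  assumes "i \<in> {1..n}"
  shows "node_degree n E i \<le> total_degree n E"
  unfolding total_degree_def using assms by (intro member_le_sum) auto

lemma emp_density_pos_iff: "emp_density n E k > 0 \<longleftrightarrow> (\<exists>i\<in>{1..n}. node_degree n E i = k)"
proof
  assume "emp_density n E k > 0"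
  then show "\<exists>i\<in>{1..n}. node_degree n E i = k"
    by (rule contrapos_pp) (auto simp: emp_density_def intro!: sum.neutral)
next
  assume "\<exists>i\<in>{1..n}. node_degree n E i = k"
  then obtain i where i: "i \<in> {1..n}" "node_degree n E i = k" by blast
  then have "(\<Sum>i=1..n. of_bool (node_degree n E i = k) :: real) > 0"
    by (intro sum_pos2[of _ i]) auto
  then show "emp_density n E k > 0"
    unfolding emp_density_def using i by (intro mult_pos_pos) auto
qed

lemma emp_joint_nonneg: "0 \<le> emp_joint n E k l"
  unfolding emp_joint_def by (intro mult_nonneg_nonneg sum_nonneg) auto

lemma emp_biased_density_nonneg: "0 \<le> emp_biased_density n E k"
  unfolding emp_biased_density_def by (intro mult_nonneg_nonneg sum_nonneg) auto

text \<open>A nonzero entry comes from an edge, whose two ends have degree at least 1 and at most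
  \<open>total_degree n E\<close>. Sums weighted by the empirical joint density thus reduce to
  finite ones.\<close>

lemma emp_joint_support:
  assumes "emp_joint n E k l \<noteq> 0"
  shows "k \<in> {1..total_degree n E}" "l \<in> {1..total_degree n E}"
proof -
  obtain i j where ij: "i \<in> {1..n}" "j \<in> {1..n}" "num_edges E i j \<noteq> 0"
      "node_degree n E i = k" "node_degree n E j = l"
  proof (rule ccontr)
    assume "\<not> thesis"
    then have "emp_joint n E k l = 0"
      using that unfolding emp_joint_def by (fastforce intro!: sum.neutral)
    with assms show False by simp
  qed
  show "k \<in> {1..total_degree n E}"
    using num_edges_le_node_degree[OF ij(2), of E i] node_degree_le_total_degree[OF ij(1), of E] ij
    by auto
  show "l \<in> {1..total_degree n E}"
    using num_edges_le_node_degree[OF ij(1), of E j] node_degree_le_total_degree[OF ij(2), of E] ij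
    by (auto simp: num_edges_commute[of E j i])
qed

text \<open>Each edge from \<open>i\<close> to \<open>j\<close> is counted for exactly one
  \<open>l\<close>, the degree of \<open>j\<close>; summing over \<open>j\<close> then turns edge
  counts into the degree of \<open>i\<close>. In an edgeless graph both sides are 0: the range of
  \<open>l\<close> is empty and \<open>1 / 0 = 0\<close>.\<close>

lemma sum_emp_joint: "(\<Sum>l=1..total_degree n E. emp_joint n E k l) = emp_biased_density n E k"
proof -
  let ?L = "total_degree n E" and ?d = "node_degree n E"
  have inner: "(\<Sum>l=1..?L. real (num_edges E i j) * of_bool (?d i = k \<and> ?d j = l)) =
      real (num_edges E i j) * of_bool (?d i = k)" if "i \<in> {1..n}" "j \<in> {1..n}" for i j
  proof (cases "num_edges E i j = 0")
    case False
    then have "?d j \<in> {1..?L}"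
      using num_edges_le_node_degree[OF that(1), of E j] node_degree_le_total_degree[OF that(2), of E]
      by (auto simp: num_edges_commute[of E j i])
    have "(\<Sum>l=1..?L. real (num_edges E i j) * of_bool (?d i = k \<and> ?d j = l)) =
        (\<Sum>l=1..?L. if ?d j = l then real (num_edges E i j) * of_bool (?d i = k) else 0)"
      by (intro sum.cong) auto
    also have "\<dots> = real (num_edges E i j) * of_bool (?d i = k)"
      using \<open>?d j \<in> {1..?L}\<close> by (subst sum.delta') auto
    finally show ?thesis .
  qed simp
  have "(\<Sum>l=1..?L. emp_joint n E k l) = (1 / real ?L) *
      (\<Sum>l=1..?L. \<Sum>i=1..n. \<Sum>j=1..n. real (num_edges E i j) * of_bool (?d i = k \<and> ?d j = l))"
    unfolding emp_joint_def by (simp add: sum_distrib_left)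
  also have "(\<Sum>l=1..?L. \<Sum>i=1..n. \<Sum>j=1..n. real (num_edges E i j) * of_bool (?d i = k \<and> ?d j = l)) =
      (\<Sum>i=1..n. \<Sum>l=1..?L. \<Sum>j=1..n. real (num_edges E i j) * of_bool (?d i = k \<and> ?d j = l))"
    by (rule sum.swap)
  also have "\<dots> = (\<Sum>i=1..n. \<Sum>j=1..n. \<Sum>l=1..?L. real (num_edges E i j) * of_bool (?d i = k \<and> ?d j = l))"
    by (intro sum.cong refl sum.swap)
  also have "\<dots> = (\<Sum>i=1..n. \<Sum>j=1..n. real (num_edges E i j) * of_bool (?d i = k))"
    by (intro sum.cong refl inner)
  \<comment> \<open>Only the degree acting as a weight on the right is unfolded into edge counts;
    the degrees in the indicators stay as they are.\<close>
  also have "\<dots> = (\<Sum>i=1..n. real (?d i) * of_bool (?d i = k))"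
    by (subst (2) node_degree_def) (simp add: sum_distrib_right)
  also have "\<dots> = (\<Sum>i=1..n. real k * of_bool (?d i = k))"
    by (intro sum.cong) auto
  finally show ?thesis by (simp add: emp_biased_density_def)
qed

text \<open>Combines the two reasons for which a degree escapes \<open>joint_error\<close>: it is
  unobserved and the indicator removes it, or it is 0 and lies outside the index set.\<close>

lemma emp_biased_density_eq_0:
  assumes "\<not> (emp_density n E k > 0 \<and> k > 0)"
  shows "emp_biased_density n E k = 0"
  using assms unfolding emp_density_pos_iff emp_biased_density_def by (auto intro!: sum.neutral)

lemma sum_emp_biased_density:
  assumes "total_degree n E > 0"
  shows "(\<Sum>k\<le>total_degree n E. emp_biased_density n E k) = 1"
proof -
  let ?L = "total_degree n E" and ?d = "node_degree n E"
  have "(\<Sum>k\<le>?L. emp_biased_density n E k) =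
      (1 / real ?L) * (\<Sum>k\<le>?L. \<Sum>i=1..n. real k * of_bool (?d i = k))"
    unfolding emp_biased_density_def by (simp add: sum_distrib_left)
  also have "(\<Sum>k\<le>?L. \<Sum>i=1..n. real k * of_bool (?d i = k)) =
      (\<Sum>i=1..n. \<Sum>k\<le>?L. real k * of_bool (?d i = k))"
    by (rule sum.swap)
  also have "\<dots> = (\<Sum>i=1..n. real (?d i))"
  proof (intro sum.cong refl)
    fix i assume "i \<in> {1..n}"
    then have "?d i \<le> ?L" by (rule node_degree_le_total_degree)
    have "(\<Sum>k\<le>?L. real k * of_bool (?d i = k)) = (\<Sum>k\<le>?L. if ?d i = k then real k else 0)"
      by (intro sum.cong) auto
    also have "\<dots> = real (?d i)"
      using \<open>?d i \<le> ?L\<close> by (subst sum.delta') auto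
    finally show "(\<Sum>k\<le>?L. real k * of_bool (?d i = k)) = real (?d i)" .
  qed
  also have "\<dots> = real ?L" by (simp add: total_degree_def)
  finally show ?thesis using assms by simp
qed

text \<open>Only an inequality, because an edgeless graph has biased density identically 0 and
  \<open>A\<close> may miss observed degrees.\<close>

lemma sum_emp_biased_density_le_1:
  assumes "finite A"
  shows "(\<Sum>k\<in>A. emp_biased_density n E k) \<le> 1"
proof (cases "total_degree n E = 0")
  case True
  then show ?thesis by (simp add: emp_biased_density_def)
next
  case False
  let ?L = "total_degree n E"
  have "emp_biased_density n E k = 0" if "k > ?L" for k
  proof (rule emp_biased_density_eq_0)
    show "\<not> (emp_density n E k > 0 \<and> k > 0)"
      using that node_degree_le_total_degree[of _ n E] unfolding emp_density_pos_iff
      by (metis linorder_not_less)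
  qed
  then have "(\<Sum>k\<in>A. emp_biased_density n E k) = (\<Sum>k\<in>A \<inter> {..?L}. emp_biased_density n E k)"
    using assms by (intro sum.mono_neutral_right) (auto simp: not_le[symmetric])
  also have "\<dots> \<le> (\<Sum>k\<le>?L. emp_biased_density n E k)"
    by (intro sum_mono2) (auto simp: emp_biased_density_nonneg)
  finally show ?thesis using sum_emp_biased_density[of n E] False by simp
qed

section \<open>The error in the joint density and in its first marginal\<close>

text \<open>The sum in the second assumption, isolated so that the estimates below concern one fixed
  graph and randomness enters only in the theorem.\<close>

definition joint_error :: "nat \<Rightarrow> multigraph \<Rightarrow> (nat \<times> nat) pmf \<Rightarrow> real" where
  "joint_error n E h = (\<Sum>\<^sub>\<infinity>(i, l)\<in>{1..} \<times> {1..}.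
     \<bar>emp_joint n E i l - pmf h (i, l)\<bar> * of_bool (emp_density n E i > 0))"

lemma pmf_summable_on: "pmf h summable_on A"
proof (rule nonneg_bdd_above_summable_on)
  have "sum (pmf h) F \<le> 1" if "finite F" for F
    using that by (simp flip: measure_measure_pmf_finite)
  then show "bdd_above (sum (pmf h) ` {F. F \<subseteq> A \<and> finite F})"
    by (intro bdd_aboveI[where M = 1]) auto
qed simp

lemma summable_on_emp_joint: "(\<lambda>x. emp_joint n E (fst x) (snd x)) summable_on A"
proof (rule summable_on_subset_banach[OF _ subset_UNIV])
  let ?B = "{1..total_degree n E}"
  show "(\<lambda>x. emp_joint n E (fst x) (snd x)) summable_on UNIV"
    using summable_on_finite[of "?B \<times> ?B" "\<lambda>x. emp_joint n E (fst x) (snd x)"] emp_joint_support[of n E]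
    by (subst summable_on_cong_neutral[where T = "?B \<times> ?B" and g = "\<lambda>x. emp_joint n E (fst x) (snd x)"])
      force+
qed

text \<open>Without summability the infinite sum in \<open>joint_error\<close> would be 0 by default
  and could not bound its partial sums. Its terms are dominated by the sum of two nonnegative
  summable densities.\<close>

lemma summable_on_joint_error:
  "(\<lambda>(i, l). \<bar>emp_joint n E i l - pmf h (i, l)\<bar> * of_bool (emp_density n E i > 0)) summable_on A"
proof -
  have "(\<lambda>x. emp_joint n E (fst x) (snd x) + pmf h x) summable_on A"
    by (intro summable_on_add summable_on_emp_joint pmf_summable_on)
  then show ?thesis
  proof (rule summable_on_comparison_test)
    fix x :: "nat \<times> nat"
    obtain i l where x: "x = (i, l)" by force
    show "(case x of (i, l) \<Rightarrow> \<bar>emp_joint n E i l - pmf h (i, l)\<bar> * of_bool (emp_density n E i > 0))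
        \<le> emp_joint n E (fst x) (snd x) + pmf h x"
      using emp_joint_nonneg[of n E i l] pmf_nonneg[of h "(i, l)"]
      unfolding x by (simp add: abs_le_iff del: pmf_nonneg)
  qed (simp add: split_beta)
qed

text \<open>The estimates below use the error only through finite sums over observed first degrees,
  where the indicator is 1.\<close>

lemma sum_le_joint_error:
  assumes "finite A" "A \<subseteq> {1..} \<times> {1..}" "\<And>i l. (i, l) \<in> A \<Longrightarrow> emp_density n E i > 0"
  shows "(\<Sum>(i, l)\<in>A. \<bar>emp_joint n E i l - pmf h (i, l)\<bar>) \<le> joint_error n E h"
proof -
  have "(\<Sum>(i, l)\<in>A. \<bar>emp_joint n E i l - pmf h (i, l)\<bar>) =
      (\<Sum>(i, l)\<in>A. \<bar>emp_joint n E i l - pmf h (i, l)\<bar> * of_bool (emp_density n E i > 0))"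
    using assms(3) by (intro sum.cong) auto
  also have "\<dots> \<le> joint_error n E h"
    unfolding joint_error_def using assms(1,2)
    by (intro finite_sum_le_infsum summable_on_joint_error) auto
  finally show ?thesis .
qed

lemma sum_pmf_le_marginal:
  assumes "finite B"
  shows "(\<Sum>l\<in>B. pmf h (i, l)) \<le> pmf (map_pmf fst h) i"
proof -
  have "(\<Sum>l\<in>B. pmf h (i, l)) = measure_pmf.prob h (Pair i ` B)"
    using assms by (subst measure_measure_pmf_finite) (auto simp: sum.reindex inj_on_def)
  also have "\<dots> \<le> measure_pmf.prob h (fst -` {i})"
    by (intro measure_pmf.finite_measure_mono) auto
  finally show ?thesis by (simp add: pmf_map)
qed

text \<open>The empirical term vanishes at degree 0 and at unobserved degrees, so discarding these
  from the marginal of \<open>h\<close> can only raise the left side; so does truncating the rows of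
  \<open>h\<close> at the total degree. What remains is a difference of row sums, bounded by the
  triangle inequality.\<close>

lemma sum_biased_minus_marginal_le:
  assumes "finite A"
  shows "(\<Sum>i\<in>A. emp_biased_density n E i) - (\<Sum>i\<in>A. pmf (map_pmf fst h) i) \<le> joint_error n E h"
proof -
  let ?L = "total_degree n E"
  define A' where "A' = {i \<in> A. emp_density n E i > 0 \<and> i > 0}"
  have A': "finite A'" "A' \<subseteq> A" using assms by (auto simp: A'_def)
  have "(\<Sum>i\<in>A. emp_biased_density n E i) = (\<Sum>i\<in>A'. emp_biased_density n E i)"
    using assms A' by (intro sum.mono_neutral_right) (auto simp: A'_def intro!: emp_biased_density_eq_0)
  moreover have "(\<Sum>i\<in>A'. pmf (map_pmf fst h) i) \<le> (\<Sum>i\<in>A. pmf (map_pmf fst h) i)"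
    using assms A' by (intro sum_mono2) auto
  moreover have "(\<Sum>i\<in>A'. \<Sum>l=1..?L. pmf h (i, l)) \<le> (\<Sum>i\<in>A'. pmf (map_pmf fst h) i)"
    by (intro sum_mono sum_pmf_le_marginal) auto
  moreover have "(\<Sum>i\<in>A'. emp_biased_density n E i) - (\<Sum>i\<in>A'. \<Sum>l=1..?L. pmf h (i, l))
      \<le> joint_error n E h"
  proof -
    have "(\<Sum>i\<in>A'. emp_biased_density n E i) - (\<Sum>i\<in>A'. \<Sum>l=1..?L. pmf h (i, l)) =
        (\<Sum>(i, l)\<in>A' \<times> {1..?L}. emp_joint n E i l - pmf h (i, l))"
      by (simp add: sum_emp_joint[symmetric] sum_subtractf sum.cartesian_product[symmetric])
    also have "\<dots> \<le> (\<Sum>(i, l)\<in>A' \<times> {1..?L}. \<bar>emp_joint n E i l - pmf h (i, l)\<bar>)"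
      by (intro sum_mono) auto
    also have "\<dots> \<le> joint_error n E h"
      using A' by (intro sum_le_joint_error) (auto simp: A'_def)
    finally show ?thesis .
  qed
  ultimately show ?thesis by linarith
qed

text \<open>
  Nodes with unobserved degree only help in the one-sided bound above; as both densities have mass
  one, applying it to the complement yields the reverse inequality.
\<close>

lemma abs_sum_biased_minus_marginal_le:
  assumes "finite A" "total_degree n E > 0"
  shows "\<bar>(\<Sum>i\<in>A. emp_biased_density n E i) - (\<Sum>i\<in>A. pmf (map_pmf fst h) i)\<bar> \<le> joint_error n E h"
proof -
  let ?b = "emp_biased_density n E" and ?m = "pmf (map_pmf fst h)"
  \<comment> \<open>A complement up to the total degree suffices: all empirical mass lies there,
    while the mass of the marginal on \<open>A \<union> B\<close> is at most 1.\<close>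
  define B where "B = {..total_degree n E} - A"
  have B: "finite B" "A \<inter> B = {}" by (auto simp: B_def)
  have "1 \<le> sum ?b (A \<union> B)"
    unfolding sum_emp_biased_density[OF assms(2), symmetric] using assms(1)
    by (intro sum_mono2) (auto simp: B_def emp_biased_density_nonneg)
  moreover have "sum ?b (A \<union> B) = sum ?b A + sum ?b B" "sum ?m (A \<union> B) = sum ?m A + sum ?m B"
    using assms(1) B by (auto intro: sum.union_disjoint)
  moreover have "sum ?m (A \<union> B) \<le> 1"
    using assms(1) B by (simp flip: measure_measure_pmf_finite)
  ultimately show ?thesis
    using sum_biased_minus_marginal_le[OF assms(1), of n E h] sum_biased_minus_marginal_le[OF B(1), of n E h]
    by linarith
qed

section \<open>Deterministic bound for the average nearest neighbor rank\<close>

text \<open>The constant 3 collects one error each from the joint density, from the distribution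
  function (weighted by \<open>q k\<close>, at most 1) and from the denominator. The last assumption
  on \<open>k\<close> makes the empirical biased density positive at \<open>k\<close>, so that
  degree \<open>k\<close> is observed.\<close>

lemma annr_error_le:
  assumes L: "total_degree n E > 0"
    and q: "q = pmf (map_pmf fst h)"
    and k: "k > 0" "q k > 0" "joint_error n E h < q k"
  shows "\<bar>annr n E k - (\<Sum>\<^sub>\<infinity>l\<in>{0<..}. pmf h (k, l) * dist_fun q l) / q k\<bar> \<le> 3 * joint_error n E h / q k"
proof -
  let ?b = "emp_biased_density n E" and ?S = "joint_error n E h" and ?L = "total_degree n E"
  have b: "\<bar>?b k - q k\<bar> \<le> ?S"
    using abs_sum_biased_minus_marginal_le[of "{k}" n E h] L q by simp
  then have bpos: "?b k > 0" using k by linarith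
  then have dens: "emp_density n E k > 0"
    using emp_biased_density_eq_0[of n E k] by force
  have F: "\<bar>dist_fun ?b l - dist_fun q l\<bar> \<le> ?S" for l
    using abs_sum_biased_minus_marginal_le[of "{..l}" n E h] L q by (simp add: dist_fun_def)
  have F01: "0 \<le> dist_fun ?b l" "dist_fun ?b l \<le> 1" for l
    by (auto simp: dist_fun_def sum_emp_biased_density_le_1 emp_biased_density_nonneg intro: sum_nonneg)
  have Q01: "0 \<le> dist_fun q l" "dist_fun q l \<le> 1" for l
    by (auto simp: dist_fun_def q sum_nonneg simp flip: measure_measure_pmf_finite)
  have Snonneg: "0 \<le> ?S" using b by linarith
  define N1 where "N1 = (\<Sum>\<^sub>\<infinity>l\<in>{0<..}. emp_joint n E k l * dist_fun ?b l)"
  define N2 where "N2 = (\<Sum>\<^sub>\<infinity>l\<in>{0<..}. pmf h (k, l) * dist_fun q l)"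
  have N1_eq: "N1 = (\<Sum>l=1..?L. emp_joint n E k l * dist_fun ?b l)"
    unfolding N1_def using emp_joint_support(2)[of n E k]
    by (subst infsum_cong_neutral[where T = "{1..?L}" and g = "\<lambda>l. emp_joint n E k l * dist_fun ?b l"]) force+
  \<comment> \<open>These bounds keep \<open>N1 / ?b k\<close> in [0, 1], so the denominator
    estimate needs no quantitative lower bound on \<open>?b k\<close>.\<close>
  have N1: "0 \<le> N1" "N1 \<le> ?b k"
  proof -
    show "0 \<le> N1"
      unfolding N1_eq by (intro sum_nonneg mult_nonneg_nonneg emp_joint_nonneg F01)
    show "N1 \<le> ?b k"
      unfolding N1_eq sum_emp_joint[symmetric, of n E k]
      by (intro sum_mono mult_left_le emp_joint_nonneg F01)
  qed
  have sum_h: "(\<lambda>l. pmf h (k, l)) summable_on A" for A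
    using pmf_summable_on[of h "Pair k ` A"] by (subst (asm) summable_on_reindex) (auto simp: inj_on_def o_def)
  have sum_N2: "(\<lambda>l. pmf h (k, l) * dist_fun q l) summable_on {0<..}"
    by (rule summable_on_comparison_test[OF sum_h]) (auto intro!: mult_nonneg_nonneg mult_left_le Q01)
  \<comment> \<open>The bound does not depend on the finite set \<open>X\<close>, so it survives the
    passage to the infinite sums.\<close>
  have partial_sums: "\<bar>(\<Sum>l\<in>X. emp_joint n E k l * dist_fun ?b l) - (\<Sum>l\<in>X. pmf h (k, l) * dist_fun q l)\<bar>
      \<le> ?S + q k * ?S" if X: "finite X" "X \<subseteq> {0<..}" for X
  proof -
    \<comment> \<open>Splitting \<open>x F - y Q = (x - y) F + y (F - Q)\<close>: here
      \<open>F\<close> is at most 1, and the weights \<open>y\<close> from row \<open>k\<close> of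
      \<open>h\<close> sum to at most \<open>q k\<close>.\<close>
    have "\<bar>(\<Sum>l\<in>X. emp_joint n E k l * dist_fun ?b l) - (\<Sum>l\<in>X. pmf h (k, l) * dist_fun q l)\<bar> =
        \<bar>\<Sum>l\<in>X. (emp_joint n E k l - pmf h (k, l)) * dist_fun ?b l + pmf h (k, l) * (dist_fun ?b l - dist_fun q l)\<bar>"
      by (simp add: sum_subtractf[symmetric] algebra_simps)
    also have "\<dots> \<le> (\<Sum>l\<in>X. \<bar>emp_joint n E k l - pmf h (k, l)\<bar> + pmf h (k, l) * ?S)"
    proof (rule order_trans[OF sum_abs], rule sum_mono)
      fix l
      have "\<bar>(emp_joint n E k l - pmf h (k, l)) * dist_fun ?b l\<bar> \<le> \<bar>emp_joint n E k l - pmf h (k, l)\<bar>"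
        using F01[of l] by (simp add: abs_mult mult_left_le)
      moreover have "\<bar>pmf h (k, l) * (dist_fun ?b l - dist_fun q l)\<bar> \<le> pmf h (k, l) * ?S"
        using F[of l] by (simp add: abs_mult mult_left_mono)
      ultimately show "\<bar>(emp_joint n E k l - pmf h (k, l)) * dist_fun ?b l + pmf h (k, l) * (dist_fun ?b l - dist_fun q l)\<bar>
          \<le> \<bar>emp_joint n E k l - pmf h (k, l)\<bar> + pmf h (k, l) * ?S"
        by linarith
    qed
    also have "\<dots> = (\<Sum>(i, l)\<in>{k} \<times> X. \<bar>emp_joint n E i l - pmf h (i, l)\<bar>) + (\<Sum>l\<in>X. pmf h (k, l)) * ?S"
      by (simp add: sum.distrib sum_distrib_right sum.cartesian_product[symmetric])
    also have "\<dots> \<le> ?S + q k * ?S"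
      using X dens k Snonneg unfolding q
      by (intro add_mono sum_le_joint_error mult_right_mono sum_pmf_le_marginal) auto
    finally show ?thesis .
  qed
  have "((\<lambda>X. \<Sum>l\<in>X. emp_joint n E k l * dist_fun ?b l) \<longlongrightarrow> N1) (finite_subsets_at_top {0<..})"
  proof -
    have "(\<lambda>l. emp_joint n E k l * dist_fun ?b l) summable_on {0<..}"
      using summable_on_finite[of "{1..?L}" "\<lambda>l. emp_joint n E k l * dist_fun ?b l"] emp_joint_support(2)[of n E k]
      by (subst summable_on_cong_neutral[where T = "{1..?L}" and g = "\<lambda>l. emp_joint n E k l * dist_fun ?b l"])
        force+
    then show ?thesis unfolding N1_def by (metis has_sum_def has_sum_infsum)
  qed
  moreover have "((\<lambda>X. \<Sum>l\<in>X. pmf h (k, l) * dist_fun q l) \<longlongrightarrow> N2) (finite_subsets_at_top {0<..})"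
    using sum_N2 unfolding N2_def by (metis has_sum_def has_sum_infsum)
  ultimately have "((\<lambda>X. \<bar>(\<Sum>l\<in>X. emp_joint n E k l * dist_fun ?b l) - (\<Sum>l\<in>X. pmf h (k, l) * dist_fun q l)\<bar>)
      \<longlongrightarrow> \<bar>N1 - N2\<bar>) (finite_subsets_at_top {0<..})"
    by (intro tendsto_intros)
  then have "\<bar>N1 - N2\<bar> \<le> ?S + q k * ?S"
    by (rule tendsto_upperbound) (auto intro!: eventually_finite_subsets_at_top_weakI partial_sums)
  also have "\<dots> \<le> 2 * ?S"
    using mult_right_mono[OF pmf_le_1[of "map_pmf fst h" k] Snonneg] q by simp
  finally have N: "\<bar>N1 - N2\<bar> \<le> 2 * ?S" .
  \<comment> \<open>Telescoping through \<open>N1 / q k\<close> puts everything over the fixed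
    \<open>q k\<close>; the error of the denominator then carries the factor
    \<open>N1 / ?b k\<close>, which is at most 1.\<close>
  have "N1 / ?b k - N2 / q k = ((N1 - N2) + N1 / ?b k * (q k - ?b k)) / q k"
    using bpos k by (simp add: field_simps)
  moreover have "\<bar>N1 / ?b k * (q k - ?b k)\<bar> \<le> 1 * ?S"
    unfolding abs_mult using N1 bpos b by (intro mult_mono) (auto simp: abs_minus_commute)
  then have "\<bar>(N1 - N2) + N1 / ?b k * (q k - ?b k)\<bar> \<le> 3 * ?S"
    using N by linarith
  ultimately have "\<bar>N1 / ?b k - N2 / q k\<bar> \<le> 3 * ?S / q k"
    using k by (simp only: abs_divide abs_of_pos divide_right_mono less_imp_le)
  then show ?thesis
    using dens by (simp add: annr_def N1_def N2_def)
qed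

section \<open>Pointwise bounds from total variation, and positivity of the size-biased
  density\<close>

lemma ennreal_term_le_suminf: "f k \<le> (\<Sum>k. f k)" for f :: "nat \<Rightarrow> ennreal"
  using sum_le_suminf[OF summableI, of "{k}" f] by simp

text \<open>The factor 2 undoes the 1/2 in \<open>dtv\<close>. Nonnegativity of \<open>x\<close>
  matters since \<open>ennreal\<close> sends negative numbers to 0.\<close>

lemma abs_diff_le_of_dtv_le:
  assumes "dtv p q \<le> ennreal x" "0 \<le> x"
  shows "\<bar>p k - q k\<bar> \<le> 2 * x"
proof -
  have "ennreal \<bar>p k - q k\<bar> \<le> (\<Sum>k. ennreal \<bar>p k - q k\<bar>)"
    by (rule ennreal_term_le_suminf)
  then have "ennreal (1/2) * ennreal \<bar>p k - q k\<bar> \<le> ennreal (1/2) * (\<Sum>k. ennreal \<bar>p k - q k\<bar>)"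
    by (rule mult_left_mono) (rule zero_le)
  also have "\<dots> \<le> ennreal x"
    using assms(1) unfolding dtv_def .
  finally have "ennreal (1/2) * ennreal \<bar>p k - q k\<bar> \<le> ennreal x" .
  then have "ennreal (1/2 * \<bar>p k - q k\<bar>) \<le> ennreal x"
    by (subst ennreal_mult) auto
  then show ?thesis
    using assms(2) by (subst (asm) ennreal_le_iff) auto
qed

text \<open>The moment assumption gives a finite mean, so the normalising series converges; its term
  at \<open>k\<close> makes it positive.\<close>

lemma size_biased_pos:
  assumes "integrable (measure_pmf f) (\<lambda>x. real x powr (1 + \<eta>))" "\<eta> > 0" "pmf f k > 0" "k > 0"
  shows "size_biased f k > 0"
proof -
  have "integrable (measure_pmf f) real"
  proof (rule Bochner_Integration.integrable_bound[OF assms(1)])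
    \<comment> \<open>A natural number is 0 or at least 1, so raising the exponent above 1 never
      decreases it.\<close>
    have "real x \<le> real x powr (1 + \<eta>)" for x :: nat
      using powr_mono[of 1 "1 + \<eta>" "real x"] assms(2) by (cases "x = 0") auto
    then show "AE x in measure_pmf f. norm (real x) \<le> norm (real x powr (1 + \<eta>))" by simp
  qed simp
  then have "summable (\<lambda>j. real j * pmf f j)"
    unfolding measure_pmf_eq_density
    by (subst (asm) integrable_density) (auto simp: integrable_count_space_nat_iff mult.commute)
  then have "(\<Sum>j. real j * pmf f j) > 0"
    using assms by (intro suminf_pos2[of _ k]) auto
  then show ?thesis using assms by (simp add: size_biased_def)
qed

section \<open>Convergence in probability from the two assumptions\<close>

theorem theorem6p1:
  fixes \<eta> \<kappa> \<delta> :: real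
    and f :: "nat pmf"
    and h :: "(nat \<times> nat) pmf"
    and M :: "nat \<Rightarrow> 'a measure"
    and G :: "nat \<Rightarrow> 'a \<Rightarrow> multigraph"
    and k :: nat
  assumes eta: "0 < \<eta>" "\<eta> < 1"
    and moment: "integrable (measure_pmf f) (\<lambda>x. real x powr (1 + \<eta>))"
    and prob: "\<And>n. n \<ge> 1 \<Longrightarrow> prob_space (M n)"
    and random_graph: "\<And>n. n \<ge> 1 \<Longrightarrow> G n \<in> measurable (M n) (count_space (multigraphs n))"
    and assm1: "\<exists>\<alpha> \<epsilon> :: real. \<alpha> > 0 \<and> \<epsilon> > 0 \<and>
      (\<lambda>n. measure (M n) (space (M n) -
          {\<omega> \<in> space (M n).
             max (d1 (emp_density n (G n \<omega>)) (pmf f))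
                 (dtv (emp_biased_density n (G n \<omega>)) (size_biased f))
               \<le> ennreal (real n powr - \<epsilon>)}))
        \<in> O(\<lambda>n. real n powr - \<alpha>)"
    and h_pos: "set_pmf h \<subseteq> {1..} \<times> {1..}"
    and kappa: "\<kappa> > 0"
    and assm2:
      "(\<lambda>n. measure (M n)
          {\<omega> \<in> space (M n).
             (\<Sum>\<^sub>\<infinity>(i, l)\<in>{1..} \<times> {1..}.
                \<bar>emp_joint n (G n \<omega>) i l - pmf h (i, l)\<bar> * of_bool (emp_density n (G n \<omega>) i > 0))
               \<le> real n powr - \<kappa>})
        \<longlonglongrightarrow> 1"
    and k: "pmf f k > 0"
    and delta: "0 < \<delta>" "\<delta> < min (\<eta> / (8 + 4 * \<eta>)) \<kappa>"
  shows "(\<lambda>n. measure (M n)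
            {\<omega> \<in> space (M n). \<bar>annr n (G n \<omega>) k - annr_limit f h k\<bar> > real n powr - \<delta>})
          \<longlonglongrightarrow> 0"
proof (cases "k = 0")
  case True
  then have "annr n E k = 0" for n E by (simp add: annr_def emp_biased_density_def)
  moreover have "annr_limit f h k = 0" using True by (simp add: annr_limit_def size_biased_def)
  ultimately show ?thesis by (simp add: not_less)
next
  case False
  let ?m = "pmf (map_pmf fst h)"
  obtain \<alpha> \<epsilon> :: real where \<alpha>: "\<alpha> > 0" and \<epsilon>: "\<epsilon> > 0" and
    O: "(\<lambda>n. measure (M n) (space (M n) -
          {\<omega> \<in> space (M n).
             max (d1 (emp_density n (G n \<omega>)) (pmf f))
                 (dtv (emp_biased_density n (G n \<omega>)) (size_biased f))
               \<le> ennreal (real n powr - \<epsilon>)}))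
        \<in> O(\<lambda>n. real n powr - \<alpha>)"
    using assm1 by blast
  define \<Omega> where "\<Omega> n = {\<omega> \<in> space (M n).
             max (d1 (emp_density n (G n \<omega>)) (pmf f))
                 (dtv (emp_biased_density n (G n \<omega>)) (size_biased f))
               \<le> ennreal (real n powr - \<epsilon>)}" for n
  define \<Gamma> where "\<Gamma> n = {\<omega> \<in> space (M n). joint_error n (G n \<omega>) h \<le> real n powr - \<kappa>}" for n
  \<comment> \<open>Graphs carry the discrete sigma-algebra, so every property of \<open>G n\<close>
    is an event.\<close>
  have meas: "{\<omega> \<in> space (M n). P (G n \<omega>)} \<in> sets (M n)" if "n \<ge> 1" for n P
  proof -
    have "G n -` {E \<in> multigraphs n. P E} \<inter> space (M n) \<in> sets (M n)"
      by (rule measurable_sets[OF random_graph[OF that]]) auto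
    also have "G n -` {E \<in> multigraphs n. P E} \<inter> space (M n) = {\<omega> \<in> space (M n). P (G n \<omega>)}"
      using measurable_space[OF random_graph[OF that]] by auto
    finally show ?thesis .
  qed
  have meas_\<Omega>: "\<Omega> n \<in> sets (M n)" and meas_\<Gamma>: "\<Gamma> n \<in> sets (M n)" if "n \<ge> 1" for n
    unfolding \<Omega>_def \<Gamma>_def by (rule meas[OF that])+
  have powr_lim: "(\<lambda>n. real n powr - s) \<longlonglongrightarrow> 0" if "s > 0" for s :: real
    using tendsto_neg_powr[of "- s" real sequentially] that filterlim_real_sequentially by simp
  have lim_\<Omega>: "(\<lambda>n. measure (M n) (space (M n) - \<Omega> n)) \<longlonglongrightarrow> 0"
    using smalloD_tendsto[OF landau_o.big_small_trans[OF O smalloI_tendsto[where g = "\<lambda>_. 1"]]]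
      powr_lim[OF \<alpha>] unfolding \<Omega>_def by simp
  have lim_\<Gamma>: "(\<lambda>n. measure (M n) (\<Gamma> n)) \<longlonglongrightarrow> 1"
    using assm2 unfolding \<Gamma>_def joint_error_def .
  have fk: "size_biased f k > 0"
    using size_biased_pos[OF moment eta(1) k] False by simp
  have diff: "\<bar>emp_biased_density n (G n \<omega>) j - size_biased f j\<bar> \<le> 2 * real n powr - \<epsilon>" if "\<omega> \<in> \<Omega> n" for n \<omega> j
    using that by (intro abs_diff_le_of_dtv_le) (auto simp: \<Omega>_def)
  have "\<forall>\<^sub>F n in sequentially. 2 * real n powr - \<epsilon> < size_biased f k"
    using tendsto_mult_right_zero[OF powr_lim[OF \<epsilon>], of 2] fk by (rule order_tendstoD(2))
  \<comment> \<open>In an edgeless graph \<open>1 / 0 = 0\<close> makes the biased density 0 at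
    \<open>k\<close>, too far from the positive \<open>size_biased f k\<close> once \<open>n\<close>
    is large.\<close>
  then have L: "\<forall>\<^sub>F n in sequentially. \<forall>\<omega>\<in>\<Omega> n. total_degree n (G n \<omega>) > 0"
  proof eventually_elim
    case (elim n)
    show ?case
    proof
      fix \<omega> assume "\<omega> \<in> \<Omega> n"
      then have "emp_biased_density n (G n \<omega>) k > 0"
        using diff[of \<omega> n k] elim by linarith
      then show "total_degree n (G n \<omega>) > 0"
        by (rule contrapos_pp) (simp add: emp_biased_density_def)
    qed
  qed
  \<comment> \<open>Any threshold strictly between 0 and 1 would do: once \<Gamma> is likelier than
    the complement of \<Omega>, the two good events meet.\<close>
  have "\<forall>\<^sub>F n in sequentially. measure (M n) (space (M n) - \<Omega> n) < 1/2"
    by (rule order_tendstoD(2)[OF lim_\<Omega>]) simp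
  moreover have "\<forall>\<^sub>F n in sequentially. 1/2 < measure (M n) (\<Gamma> n)"
    by (rule order_tendstoD(1)[OF lim_\<Gamma>]) simp
  ultimately have ex: "\<forall>\<^sub>F n in sequentially. \<exists>\<omega>. \<omega> \<in> \<Omega> n \<inter> \<Gamma> n"
    using eventually_ge_at_top[of 1]
  proof eventually_elim
    case (elim n)
    interpret prob_space "M n" using prob elim by simp
    show ?case
    proof (rule ccontr)
      assume "\<nexists>\<omega>. \<omega> \<in> \<Omega> n \<inter> \<Gamma> n"
      then have "\<Gamma> n \<subseteq> space (M n) - \<Omega> n" by (auto simp: \<Gamma>_def)
      then have "measure (M n) (\<Gamma> n) \<le> measure (M n) (space (M n) - \<Omega> n)"
        using meas_\<Omega>[of n] elim by (intro finite_measure_mono) auto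
      then show False using elim by linarith
    qed
  qed
  \<comment> \<open>A deterministic identity: it needs only one good outcome for each large \<open>n\<close>.\<close>
  have eq: "size_biased f = ?m"
  proof
    fix j
    have "\<forall>\<^sub>F n in sequentially. \<bar>size_biased f j - ?m j\<bar> \<le> 2 * real n powr - \<epsilon> + real n powr - \<kappa>"
      using ex L
    proof eventually_elim
      case (elim n)
      then obtain \<omega> where \<omega>: "\<omega> \<in> \<Omega> n" "\<omega> \<in> \<Gamma> n" by blast
      then have "\<bar>emp_biased_density n (G n \<omega>) j - ?m j\<bar> \<le> joint_error n (G n \<omega>) h"
        using abs_sum_biased_minus_marginal_le[of "{j}" n "G n \<omega>" h] elim by simp
      then show ?case using diff[OF \<omega>(1), of j] \<omega>(2) by (auto simp: \<Gamma>_def)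
    qed
    moreover have "(\<lambda>n. 2 * real n powr - \<epsilon> + real n powr - \<kappa>) \<longlonglongrightarrow> 2 * 0 + 0"
      by (intro tendsto_intros powr_lim \<epsilon> kappa)
    ultimately have "\<bar>size_biased f j - ?m j\<bar> \<le> 2 * 0 + 0"
      by (intro tendsto_lowerbound[where F = sequentially]) auto
    then show "size_biased f j = ?m j" by simp
  qed
  \<comment> \<open>The gap \<open>\<kappa> - \<delta> > 0\<close> absorbs the constant 3 and the
    division by \<open>?m k\<close>.\<close>
  have small: "\<forall>\<^sub>F n in sequentially. 3 * real n powr - \<kappa> / ?m k \<le> real n powr - \<delta>"
  proof -
    have "(\<lambda>n. 3 * real n powr - (\<kappa> - \<delta>)) \<longlonglongrightarrow> 3 * 0"
      using delta by (intro tendsto_intros powr_lim) simp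
    then have "\<forall>\<^sub>F n in sequentially. 3 * real n powr - (\<kappa> - \<delta>) < ?m k"
      using fk eq by (intro order_tendstoD(2)) auto
    then show ?thesis
    proof eventually_elim
      case (elim n)
      have "3 * real n powr - \<kappa> = 3 * real n powr - (\<kappa> - \<delta>) * real n powr - \<delta>"
        by (simp add: powr_add[symmetric])
      also have "\<dots> \<le> ?m k * real n powr - \<delta>"
        using elim by (intro mult_right_mono) auto
      finally show ?case using fk eq by (simp add: field_simps)
    qed
  qed
  define B where "B n = {\<omega> \<in> space (M n). \<bar>annr n (G n \<omega>) k - annr_limit f h k\<bar> > real n powr - \<delta>}" for n
  have "\<forall>\<^sub>F n in sequentially. real n powr - \<kappa> < ?m k"
    using powr_lim[OF kappa] fk eq by (intro order_tendstoD(2)) auto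
  with L small eventually_ge_at_top[of 1]
  have "\<forall>\<^sub>F n in sequentially. measure (M n) (B n) \<le> measure (M n) (space (M n) - \<Omega> n) + (1 - measure (M n) (\<Gamma> n))"
  proof eventually_elim
    case (elim n)
    interpret prob_space "M n" using prob elim by simp
    \<comment> \<open>\<open>\<Omega> n\<close> supplies an edge and \<open>\<Gamma> n\<close> the
      error bound, so the deterministic estimate rules out a large deviation when both hold.\<close>
    have "B n \<subseteq> (space (M n) - \<Omega> n) \<union> (space (M n) - \<Gamma> n)"
    proof (rule ccontr)
      assume "\<not> ?thesis"
      then obtain \<omega> where \<omega>: "\<omega> \<in> B n" "\<omega> \<in> \<Omega> n" "\<omega> \<in> \<Gamma> n" by (auto simp: B_def)
      then have S: "joint_error n (G n \<omega>) h \<le> real n powr - \<kappa>" by (simp add: \<Gamma>_def)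
      have "\<bar>annr n (G n \<omega>) k - (\<Sum>\<^sub>\<infinity>l\<in>{0<..}. pmf h (k, l) * dist_fun ?m l) / ?m k\<bar>
          \<le> 3 * joint_error n (G n \<omega>) h / ?m k"
        using elim \<omega> S fk eq False by (intro annr_error_le refl) auto
      also have "\<dots> \<le> 3 * real n powr - \<kappa> / ?m k"
        using S by (intro divide_right_mono) auto
      also have "\<dots> \<le> real n powr - \<delta>" using elim by simp
      finally show False using \<omega>(1) k eq by (simp add: B_def annr_limit_def)
    qed
    then have "measure (M n) (B n) \<le> measure (M n) ((space (M n) - \<Omega> n) \<union> (space (M n) - \<Gamma> n))"
      using meas_\<Omega>[of n] meas_\<Gamma>[of n] elim by (intro finite_measure_mono) auto
    also have "\<dots> \<le> measure (M n) (space (M n) - \<Omega> n) + measure (M n) (space (M n) - \<Gamma> n)"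
      using meas_\<Omega>[of n] meas_\<Gamma>[of n] elim by (intro measure_Un_le) auto
    finally show ?case using meas_\<Gamma>[of n] elim by (simp add: prob_compl)
  qed
  moreover have "(\<lambda>n. measure (M n) (space (M n) - \<Omega> n) + (1 - measure (M n) (\<Gamma> n))) \<longlonglongrightarrow> 0 + (1 - 1)"
    by (intro tendsto_intros lim_\<Omega> lim_\<Gamma>)
  ultimately have "(\<lambda>n. measure (M n) (B n)) \<longlonglongrightarrow> 0"
    using tendsto_sandwich[OF always_eventually _ tendsto_const, of 0 "\<lambda>n. measure (M n) (B n)"] by simp
  then show ?thesis unfolding B_def .
qed

end
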